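(* Let $m\to\infty$. Then $f(m,H_3(b_1,b_2,1))$ is bounded when $b_1=\Omega(m\,b_2)$, and it is unbounded when either $b_1+b_2=o(m)$ or $b_1=o(\sqrt m\,b_2)$. Here $b_1=b_1(m)$ and $b_2=b_2(m)$ may depend on $m$.
   Context: A hypergraph $H$ on a finite vertex set $V(H)$ is a subset of $2^{V(H)}$; its elements are its edges, $|F|$ denotes the number of edges of $F$, and a subgraph of $F$ is given by a subset of its edges. $F$ is $H$-free if it contains no copy of $H$ as a (not necessarily induced) subgraph. Let $\mathrm{ex}(F,H)$ be the maximum number of edges of an $H$-free subgraph of $F$, and $f(m,H):=\min_{|F|=m}\mathrm{ex}(F,H)$, the minimum being over all hypergraphs $F$ with $m$ edges (not necessarily uniform). For nonnegative integers $b_1,b_2,b_3$, $H_3(b_1,b_2,b_3)$ denotes the 3-edge hypergraph $\{A_1,A_2,A_3\}$ (unique up to isomorphism) in which, for each $\ell\in\{1,2,3\}$ and each $I\subseteq\{1,2,3\}$ with $|I|=\ell$, exactly $b_\ell$ vertices lie in all $A_i$, $i\in I$, and in no $A_i$, $i\notin I$. The asymptotic notation $\Omega(\cdot)$ and $o(\cdot)$ is the standard one, as $m\to\infty$.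
   Formalization: In the case b_1+b_2=o(m), it is additionally assumed that b_2(m)>0 for all large m; otherwise the claim fails: for b_1=1, b_2=0 a star with m edges gives f(m,H_3(1,0,1)) ≤ 2. Also, b_1+b_2>0 for large m, so that H_3 has three edges. *)

theory Defs
  imports Complex_Main "HOL-Library.Landau_Symbols"
begin

text \<open>A hypergraph is a pair of its vertex set and its edge set; edges of different sizes (and
  the empty edge) are allowed.\<close>

type_synonym 'a hypergraph = "'a set \<times> 'a set set"

abbreviation verts :: "'a hypergraph \<Rightarrow> 'a set" where "verts \<equiv> fst"
abbreviation edges :: "'a hypergraph \<Rightarrow> 'a set set" where "edges \<equiv> snd"

definition hypergraph :: "'a hypergraph \<Rightarrow> bool" where
  "hypergraph F \<longleftrightarrow> finite (verts F) \<and> edges F \<subseteq> Pow (verts F)"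

definition contains_copy :: "'a hypergraph \<Rightarrow> 'b hypergraph \<Rightarrow> bool" where
  "contains_copy F H \<longleftrightarrow>
     (\<exists>\<phi>. inj_on \<phi> (verts H) \<and> \<phi> ` verts H \<subseteq> verts F \<and> (\<forall>A\<in>edges H. \<phi> ` A \<in> edges F))"

definition hfree :: "'b hypergraph \<Rightarrow> 'a hypergraph \<Rightarrow> bool" where
  "hfree H F \<longleftrightarrow> \<not> contains_copy F H"

definition ex_num :: "'a hypergraph \<Rightarrow> 'b hypergraph \<Rightarrow> nat" where
  "ex_num F H = Max {card G | G. G \<subseteq> edges F \<and> hfree H (verts F, G)}"

text \<open>The vertices of the host hypergraphs are taken from \<^typ>\<open>nat\<close>; this is no restriction
  since vertex sets are finite. The set below is never empty, so \<^const>\<open>Inf\<close> is its minimum.\<close>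

definition f_min :: "nat \<Rightarrow> 'b hypergraph \<Rightarrow> nat" where
  "f_min m H = Inf {ex_num F H | F :: nat hypergraph. hypergraph F \<and> card (edges F) = m}"

lemma hypergraph_exists: "\<exists>F :: nat hypergraph. hypergraph F \<and> card (edges F) = m"
proof -
  have "card ((\<lambda>i. {i}) ` {..<m}) = m"
    by (simp add: card_image)
  then have "hypergraph ({..<m}, (\<lambda>i. {i}) ` {..<m}) \<and>
      card (edges ({..<m}, (\<lambda>i. {i}) ` {..<m})) = m"
    by (auto simp: hypergraph_def)
  then show ?thesis by blast
qed

text \<open>The vertices lying in exactly the edges indexed by \<open>I\<close> are the pairs \<open>(I, j)\<close> with
  \<open>j < H3_mult b1 b2 b3 (card I)\<close>.\<close>

definition H3_mult :: "nat \<Rightarrow> nat \<Rightarrow> nat \<Rightarrow> nat \<Rightarrow> nat" where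
  "H3_mult b1 b2 b3 l = (if l = 1 then b1 else if l = 2 then b2 else b3)"

definition H3_verts :: "nat \<Rightarrow> nat \<Rightarrow> nat \<Rightarrow> (nat set \<times> nat) set" where
  "H3_verts b1 b2 b3 = {(I, j). I \<subseteq> {1, 2, 3} \<and> I \<noteq> {} \<and> j < H3_mult b1 b2 b3 (card I)}"

definition H3_edge :: "nat \<Rightarrow> nat \<Rightarrow> nat \<Rightarrow> nat \<Rightarrow> (nat set \<times> nat) set" where
  "H3_edge b1 b2 b3 i = {v \<in> H3_verts b1 b2 b3. i \<in> fst v}"

definition H3 :: "nat \<Rightarrow> nat \<Rightarrow> nat \<Rightarrow> (nat set \<times> nat) hypergraph" where
  "H3 b1 b2 b3 = (H3_verts b1 b2 b3, H3_edge b1 b2 b3 ` {1, 2, 3})"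

lemma H3_region:
  assumes "I \<subseteq> {1, 2, 3}" "I \<noteq> {}"
  shows "card {v \<in> verts (H3 b1 b2 b3). \<forall>i\<in>{1, 2, 3}. v \<in> H3_edge b1 b2 b3 i \<longleftrightarrow> i \<in> I}
    = H3_mult b1 b2 b3 (card I)"
proof -
  have "{v \<in> verts (H3 b1 b2 b3). \<forall>i\<in>{1, 2, 3}. v \<in> H3_edge b1 b2 b3 i \<longleftrightarrow> i \<in> I}
      = {I} \<times> {..<H3_mult b1 b2 b3 (card I)}" (is "?L = ?R")
  proof
    show "?L \<subseteq> ?R"
    proof
      fix v assume v: "v \<in> ?L"
      then have "fst v \<subseteq> {1, 2, 3}" "\<forall>i\<in>{1, 2, 3}. i \<in> fst v \<longleftrightarrow> i \<in> I"
        by (auto simp: H3_def H3_edge_def H3_verts_def)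
      then have "fst v = I" using assms by blast
      then show "v \<in> ?R" using v by (cases v) (auto simp: H3_def H3_verts_def)
    qed
    show "?R \<subseteq> ?L" using assms by (auto simp: H3_def H3_edge_def H3_verts_def)
  qed
  then show ?thesis by (simp add: card_cartesian_product)
qed

text \<open>If \<open>b1 = b2 = 0\<close>, the three edges coincide, so this case has to be excluded.\<close>

lemma card_edges_H3: "card (edges (H3 b1 b2 b3)) = 3 \<longleftrightarrow> b1 + b2 > 0"
proof
  assume c: "card (edges (H3 b1 b2 b3)) = 3"
  show "b1 + b2 > 0"
  proof (rule ccontr)
    assume "\<not> b1 + b2 > 0"
    then have z: "b1 = 0" "b2 = 0" by auto
    have full: "I = {1, 2, 3}"
      if "I \<subseteq> {1, 2, 3}" "I \<noteq> {}" "j < H3_mult 0 0 b3 (card I)" for I :: "nat set" and j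
    proof -
      have "finite I" using that(1) by (rule finite_subset) simp
      then have "card I \<noteq> 0" "card I \<noteq> 1" "card I \<noteq> 2"
        using that by (auto simp: H3_mult_def split: if_splits)
      moreover have "card I \<le> 3" using card_mono[OF _ that(1)] by simp
      ultimately have "card I = card {1, 2, 3::nat}" by simp
      then show ?thesis using that(1) by (intro card_subset_eq) auto
    qed
    have "H3_edge b1 b2 b3 i = H3_verts b1 b2 b3" if "i \<in> {1, 2, 3}" for i
    proof -
      have "i \<in> fst v" if v: "v \<in> H3_verts 0 0 b3" for v
      proof -
        have "fst v = {1, 2, 3}"
          using v by (intro full[of "fst v" "snd v"]) (auto simp: H3_verts_def)
        then show ?thesis using \<open>i \<in> {1, 2, 3}\<close> by (simp only:)
      qed
      then show ?thesis by (auto simp: H3_edge_def z)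
    qed
    then have "edges (H3 b1 b2 b3) = {H3_verts b1 b2 b3}"
      by (auto simp: H3_def)
    then show False using c by simp
  qed
next
  assume b: "b1 + b2 > 0"
  have ne: "H3_edge b1 b2 b3 i \<noteq> H3_edge b1 b2 b3 j"
    if ij: "i \<in> {1, 2, 3}" "j \<in> {1, 2, 3}" "i \<noteq> j" for i j
  proof (cases "b1 > 0")
    case True
    then have "({i}, 0) \<in> H3_edge b1 b2 b3 i - H3_edge b1 b2 b3 j"
      using ij by (auto simp: H3_edge_def H3_verts_def H3_mult_def)
    then show ?thesis by blast
  next
    case False
    then have "b2 > 0" using b by simp
    moreover have "card ({1, 2, 3} - {j}) = 2" using ij by auto
    ultimately have "({1, 2, 3} - {j}, 0) \<in> H3_edge b1 b2 b3 i - H3_edge b1 b2 b3 j"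
      using ij by (auto simp: H3_edge_def H3_verts_def H3_mult_def)
    then show ?thesis by blast
  qed
  then have "inj_on (H3_edge b1 b2 b3) {1, 2, 3}" by (intro inj_onI) blast
  then show "card (edges (H3 b1 b2 b3)) = 3" by (simp add: H3_def card_image)
qed

end

theory Submission
  imports Defs
begin

text \<open>
  Write \<open>H\<close> for the three-edge hypergraph and \<open>k = b1 + 2 * b2 + 1\<close> for the size of its edges.

  Boundedness. Take a block of \<open>g\<close> edges with one vertex common to all of them, \<open>b2\<close> vertices for
  every pair of edges, and some private vertices. Within a triple of these edges, an edge has its
  private vertices and those of its \<open>g - 3\<close> pairs with an edge outside the triple to itself. If
  \<open>(g - 3) * b2 \<le> b1\<close>, the number of private vertices can be chosen so that this makes \<open>b1\<close>
  altogether; then every triple is a copy of \<open>H\<close>, so a free subgraph has at most two edges in the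
  block. When \<open>b1 \<ge> c * m * b2\<close>, blocks of size about \<open>c * m\<close> are possible, and about \<open>1 / c\<close>
  disjoint ones suffice for \<open>m\<close> edges (\<open>f_min_le_blocks\<close>).

  Unboundedness. Suppose that no free subgraph of the host has more than \<open>T\<close> edges. All
  estimates come from one pigeonhole argument (\<open>popular_pair\<close>), which replaces a supersaturation
  theorem: in any family of edges, fix a largest free subfamily; every further edge completes a
  copy with two of its at most \<open>T\<close> members, so some pair of edges is completed by a proportion of at
  least about \<open>1 / T\<^sup>2\<close> of the family. This is used twice.
  First, since the three edges of a copy share a single vertex, any two vertices lie in at most
  \<open>T\<close> common edges. Among the edges at a vertex \<open>v\<close>, many therefore meet one fixed edge in \<open>b2\<close>
  vertices other than \<open>v\<close>, although each of its at most \<open>k\<close> vertices absorbs at most \<open>T\<close> of them;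
  this bounds all degrees by a constant times \<open>k / b2\<close> (\<open>degree_le\<close>).
  Second, apply the argument to the whole host, giving edges \<open>A\<close> and \<open>B\<close> and a number of third
  edges \<open>C\<close> proportional to \<open>m\<close>. Every such \<open>C\<close> contains a vertex of \<open>A \<inter> B\<close>, a set of size
  \<open>b2 + 1\<close>, so \<open>m\<close> is at most a constant times \<open>(b2 + 1) * k / b2\<close>, hence of order at most \<open>k\<close>. Every
  such \<open>C\<close> also meets \<open>A\<close> in \<open>b2 + 1\<close> vertices, and \<open>A\<close> has only \<open>k\<close> vertices, so \<open>m * (b2 + 1)\<close>
  is at most a constant times \<open>k * (k / b2)\<close>. The first bound excludes \<open>b1 + b2 = o(m)\<close>,
  the second one excludes \<open>b1 = o(sqrt m * b2)\<close>.
\<close>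

section \<open>Copies and triples of edges\<close>

text \<open>The sizes of the intersections in a copy. Counting needs nothing else about a copy, and in this
  form the symmetry in the three edges is evident, while an embedding singles out their order.\<close>

definition H3_triple :: "nat \<Rightarrow> nat \<Rightarrow> 'a set \<Rightarrow> 'a set \<Rightarrow> 'a set \<Rightarrow> bool" where
  "H3_triple b1 b2 A B C \<longleftrightarrow>
     (\<forall>X\<in>{A, B, C}. card X = b1 + 2 * b2 + 1) \<and>
     card (A \<inter> B) = b2 + 1 \<and> card (A \<inter> C) = b2 + 1 \<and> card (B \<inter> C) = b2 + 1 \<and>
     card (A \<inter> B \<inter> C) = 1"

lemma H3_triple_commute:
  "H3_triple b1 b2 A B C \<Longrightarrow> H3_triple b1 b2 B A C"
  "H3_triple b1 b2 A B C \<Longrightarrow> H3_triple b1 b2 A C B"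
  by (auto simp: H3_triple_def Int_ac)

lemma H3_triple_distinct:
  assumes "H3_triple b1 b2 A B C" "b2 > 0"
  shows "A \<noteq> B" "A \<noteq> C" "B \<noteq> C"
  using assms by (auto simp: H3_triple_def)

text \<open>A vertex \<open>(I, j)\<close> lies in the edges with index in \<open>J\<close> exactly if \<open>J \<subseteq> I\<close>, so the intersection
  is a union of regions.\<close>

lemma card_Inter_H3_edges:
  assumes "J \<subseteq> {1, 2, 3}" "J \<noteq> {}"
  shows "card (\<Inter>i\<in>J. H3_edge b1 b2 b3 i) =
    (\<Sum>I | I \<in> Pow {1, 2, 3} \<and> J \<subseteq> I. H3_mult b1 b2 b3 (card I))"
proof -
  have "(\<Inter>i\<in>J. H3_edge b1 b2 b3 i) =
      (SIGMA I:{I \<in> Pow {1, 2, 3}. J \<subseteq> I}. {..<H3_mult b1 b2 b3 (card I)})"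
    using assms by (auto simp: H3_edge_def H3_verts_def)
  then show ?thesis by simp
qed

lemma card_H3_edge:
  assumes "i \<in> {1, 2, 3}"
  shows "card (H3_edge b1 b2 1 i) = b1 + 2 * b2 + 1"
proof -
  obtain j l where jl: "{1, 2, 3} = {i, j, l}" "i \<noteq> j" "i \<noteq> l" "j \<noteq> l"
  proof -
    from assms consider "i = 1" | "i = 2" | "i = 3" by blast
    then show thesis
    proof cases
      case 1 show ?thesis by (rule that[of 2 3]) (auto simp: 1)
    next
      case 2 show ?thesis by (rule that[of 1 3]) (auto simp: 2)
    next
      case 3 show ?thesis by (rule that[of 1 2]) (auto simp: 3)
    qed
  qed
  have eq: "{I \<in> Pow {1, 2, 3}. {i} \<subseteq> I} = {{i}, {i, j}, {i, l}, {i, j, l}}"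
    unfolding jl(1) using jl(2-4) by (auto simp: Pow_insert)
  have cards: "card {i, j} = 2" "card {i, l} = 2" "card {i, j, l} = 3"
    using jl(2-4) by auto
  have "{i, j} \<noteq> {i, l}" using jl(2-4) by (auto simp: doubleton_eq_iff)
  moreover have "{i} \<noteq> {i, j}" "{i} \<noteq> {i, l}" "{i} \<noteq> {i, j, l}" using jl(2-4) by blast+
  moreover have "{i, j} \<noteq> {i, j, l}" "{i, l} \<noteq> {i, j, l}" using jl(2-4) by auto
  ultimately have "(\<Sum>I\<in>{{i}, {i, j}, {i, l}, {i, j, l}}. H3_mult b1 b2 1 (card I)) =
      H3_mult b1 b2 1 (card {i}) + H3_mult b1 b2 1 (card {i, j}) +
      H3_mult b1 b2 1 (card {i, l}) + H3_mult b1 b2 1 (card {i, j, l})"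
    by (simp only: sum.insert finite.intros insert_iff empty_iff sum.empty simp_thms add.right_neutral
        add.assoc)
  also have "\<dots> = b1 + 2 * b2 + 1" unfolding cards by (simp add: H3_mult_def)
  finally show ?thesis
    using card_Inter_H3_edges[of "{i}" b1 b2 1] assms unfolding eq by simp
qed

lemma card_H3_edge_Int:
  assumes "i \<in> {1, 2, 3}" "j \<in> {1, 2, 3}" "i \<noteq> j"
  shows "card (H3_edge b1 b2 1 i \<inter> H3_edge b1 b2 1 j) = b2 + 1"
proof -
  have c: "card {i, j} = 2" "card {1, 2, 3::nat} = 3" using assms by auto
  then have ne: "{i, j} \<noteq> {1, 2, 3}" by auto
  have eq: "{I \<in> Pow {1, 2, 3}. {i, j} \<subseteq> I} = {{i, j}, {1, 2, 3}}"
  proof (intro equalityI subsetI)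
    fix I assume I: "I \<in> {I \<in> Pow {1, 2, 3}. {i, j} \<subseteq> I}"
    show "I \<in> {{i, j}, {1, 2, 3}}"
    proof (cases "I = {i, j}")
      case False
      have fin: "finite I" using I by (auto intro: finite_subset)
      then have "card {i, j} < card I" using I False by (intro psubset_card_mono) auto
      then have "I = {1, 2, 3}" using I c by (intro card_seteq) auto
      then show ?thesis by simp
    qed simp
  qed (use assms in auto)
  have "card (\<Inter>l\<in>{i, j}. H3_edge b1 b2 1 l) = H3_mult b1 b2 1 2 + H3_mult b1 b2 1 3"
    using card_Inter_H3_edges[of "{i, j}" b1 b2 1] assms ne
    unfolding eq by (simp add: c del: One_nat_def)
  then show ?thesis by (simp add: H3_mult_def)
qed

lemma card_H3_edge_Int3:
  "card (H3_edge b1 b2 1 1 \<inter> H3_edge b1 b2 1 2 \<inter> H3_edge b1 b2 1 3) = 1"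
proof -
  have eq: "{I \<in> Pow {1, 2, 3}. {1, 2, 3::nat} \<subseteq> I} = {{1, 2, 3}}" by auto
  show ?thesis
    using card_Inter_H3_edges[of "{1, 2, 3}" b1 b2 1] unfolding eq
    by (simp add: H3_mult_def Int_assoc)
qed

text \<open>The last conclusion remembers that the three edges carry a copy by themselves, so that they
  cannot all belong to a free family.\<close>

lemma contains_copy_imp_triple:
  assumes "contains_copy (V, G) (H3 b1 b2 1)"
  obtains A B C where "A \<in> G" "B \<in> G" "C \<in> G" "H3_triple b1 b2 A B C"
    "contains_copy (V, {A, B, C}) (H3 b1 b2 1)"
proof -
  obtain \<phi> where inj: "inj_on \<phi> (H3_verts b1 b2 1)" and V: "\<phi> ` H3_verts b1 b2 1 \<subseteq> V"
    and G: "\<forall>i\<in>{1, 2, 3}. \<phi> ` H3_edge b1 b2 1 i \<in> G"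
    using assms by (auto simp: contains_copy_def H3_def)
  have sub: "H3_edge b1 b2 1 i \<subseteq> H3_verts b1 b2 1" for i
    by (auto simp: H3_edge_def)
  have card_img: "card (\<phi> ` S) = card S" if "S \<subseteq> H3_verts b1 b2 1" for S
    using inj that by (meson card_image inj_on_subset)
  have Int: "\<phi> ` S \<inter> \<phi> ` S' = \<phi> ` (S \<inter> S')"
    if "S \<subseteq> H3_verts b1 b2 1" "S' \<subseteq> H3_verts b1 b2 1" for S S'
    using inj that by (metis inj_on_image_Int)
  let ?e = "H3_edge b1 b2 1"
  have I3: "\<phi> ` ?e 1 \<inter> \<phi> ` ?e 2 \<inter> \<phi> ` ?e 3 = \<phi> ` (?e 1 \<inter> ?e 2 \<inter> ?e 3)"
    using sub by (simp add: Int le_infI1)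
  have sub2: "?e i \<inter> ?e j \<subseteq> H3_verts b1 b2 1" for i j using sub by blast
  have sub3: "?e 1 \<inter> ?e 2 \<inter> ?e 3 \<subseteq> H3_verts b1 b2 1" using sub by blast
  have one: "card (\<phi> ` ?e i) = b1 + 2 * b2 + 1" if "i \<in> {1, 2, 3}" for i
    by (simp only: card_img[OF sub] card_H3_edge[OF that])
  have two: "card (\<phi> ` ?e i \<inter> \<phi> ` ?e j) = b2 + 1"
    if "i \<in> {1, 2, 3}" "j \<in> {1, 2, 3}" "i \<noteq> j" for i j
    by (simp only: Int[OF sub sub] card_img[OF sub2] card_H3_edge_Int[OF that])
  have three: "card (\<phi> ` ?e 1 \<inter> \<phi> ` ?e 2 \<inter> \<phi> ` ?e 3) = 1"
    unfolding I3 card_img[OF sub3] by (rule card_H3_edge_Int3)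
  have "H3_triple b1 b2 (\<phi> ` ?e 1) (\<phi> ` ?e 2) (\<phi> ` ?e 3)"
    using one[of 1] one[of 2] one[of 3] two[of 1 2] two[of 1 3] two[of 2 3] three
    by (simp add: H3_triple_def)
  moreover have "contains_copy (V, {\<phi> ` ?e 1, \<phi> ` ?e 2, \<phi> ` ?e 3}) (H3 b1 b2 1)"
    unfolding contains_copy_def using inj V by (intro exI[of _ \<phi>]) (auto simp: H3_def)
  ultimately show thesis using G that by blast
qed

lemma contains_copy_mono:
  assumes "contains_copy (V, G) H" "G \<subseteq> G'"
  shows "contains_copy (V, G') H"
proof -
  obtain \<phi> where "inj_on \<phi> (verts H)" "\<phi> ` verts H \<subseteq> V" "\<forall>A\<in>edges H. \<phi> ` A \<in> G"
    using assms(1) by (auto simp: contains_copy_def)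
  then show ?thesis
    unfolding contains_copy_def using assms(2) by (intro exI[of _ \<phi>]) (simp add: subset_iff)
qed

text \<open>A configuration of three sets is determined up to isomorphism by the sizes of its regions:
  bijections between corresponding regions can be glued to an embedding.\<close>

lemma contains_copyI:
  fixes X :: "nat \<Rightarrow> 'a set"
  assumes fin: "finite V" and sub: "\<And>i. i \<in> {1, 2, 3} \<Longrightarrow> X i \<in> G \<and> X i \<subseteq> V"
    and region: "\<And>I. I \<subseteq> {1, 2, 3} \<Longrightarrow> I \<noteq> {} \<Longrightarrow>
      card {v \<in> V. \<forall>i\<in>{1, 2, 3}. v \<in> X i \<longleftrightarrow> i \<in> I} = H3_mult b1 b2 b3 (card I)"
  shows "contains_copy (V, G) (H3 b1 b2 b3)"
proof -
  define R where "R I = {v \<in> V. \<forall>i\<in>{1, 2, 3::nat}. v \<in> X i \<longleftrightarrow> i \<in> I}" for I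
  have "\<exists>g. bij_betw g {..<H3_mult b1 b2 b3 (card I)} (R I)" if "I \<subseteq> {1, 2, 3}" "I \<noteq> {}" for I
  proof -
    have "finite (R I)" using fin by (simp add: R_def)
    moreover have "card (R I) = H3_mult b1 b2 b3 (card I)" unfolding R_def using region that by blast
    ultimately show ?thesis by (intro finite_same_card_bij) auto
  qed
  then obtain g where g: "\<And>I. I \<subseteq> {1, 2, 3} \<Longrightarrow> I \<noteq> {} \<Longrightarrow>
      bij_betw (g I) {..<H3_mult b1 b2 b3 (card I)} (R I)"
    by metis
  define \<phi> where "\<phi> v = g (fst v) (snd v)" for v
  have mem: "\<phi> v \<in> R (fst v)" if "v \<in> H3_verts b1 b2 b3" for v
  proof -
    have v: "fst v \<subseteq> {1, 2, 3}" "fst v \<noteq> {}" "snd v < H3_mult b1 b2 b3 (card (fst v))"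
      using that by (auto simp: H3_verts_def)
    then show ?thesis using bij_betwE[OF g[OF v(1,2)]] by (simp add: \<phi>_def)
  qed
  have R_unique: "I = I'" if "x \<in> R I" "x \<in> R I'" "I \<subseteq> {1, 2, 3}" "I' \<subseteq> {1, 2, 3}" for x I I'
    using that unfolding R_def by blast
  have inj: "inj_on \<phi> (H3_verts b1 b2 b3)"
  proof (rule inj_onI)
    fix v w assume vw: "v \<in> H3_verts b1 b2 b3" "w \<in> H3_verts b1 b2 b3" "\<phi> v = \<phi> w"
    then have eq: "fst v = fst w"
      using R_unique[of "\<phi> v" "fst v" "fst w"] mem[of v] mem[of w]
      by (auto simp: H3_verts_def)
    have "fst v \<subseteq> {1, 2, 3}" "fst v \<noteq> {}" using vw(1) by (auto simp: H3_verts_def)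
    from g[OF this] have "inj_on (g (fst v)) {..<H3_mult b1 b2 b3 (card (fst v))}"
      by (rule bij_betw_imp_inj_on)
    then have "snd v = snd w"
      using vw eq by (auto simp: H3_verts_def \<phi>_def inj_on_def)
    then show "v = w" using eq by (simp add: prod_eq_iff)
  qed
  have img: "\<phi> ` H3_edge b1 b2 b3 i = X i" if i: "i \<in> {1, 2, 3}" for i
  proof
    show "\<phi> ` H3_edge b1 b2 b3 i \<subseteq> X i"
    proof
      fix x assume "x \<in> \<phi> ` H3_edge b1 b2 b3 i"
      then obtain v where v: "v \<in> H3_verts b1 b2 b3" "i \<in> fst v" "x = \<phi> v"
        by (auto simp: H3_edge_def)
      then have "\<forall>l\<in>{1, 2, 3}. x \<in> X l \<longleftrightarrow> l \<in> fst v" using mem[OF v(1)] unfolding R_def by blast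
      then show "x \<in> X i" using i v(2) by blast
    qed
    show "X i \<subseteq> \<phi> ` H3_edge b1 b2 b3 i"
    proof
      fix x assume x: "x \<in> X i"
      define I where "I = {l \<in> {1, 2, 3}. x \<in> X l}"
      have I: "I \<subseteq> {1, 2, 3}" "i \<in> I" and xR: "x \<in> R I"
        using x i sub[OF i] unfolding I_def R_def by blast+
      then have "x \<in> g I ` {..<H3_mult b1 b2 b3 (card I)}"
        using bij_betw_imp_surj_on[OF g[of I]] by blast
      then obtain j where "j < H3_mult b1 b2 b3 (card I)" "x = g I j" by blast
      then have "(I, j) \<in> H3_edge b1 b2 b3 i" "x = \<phi> (I, j)"
        using I by (auto simp: H3_edge_def H3_verts_def \<phi>_def)
      then show "x \<in> \<phi> ` H3_edge b1 b2 b3 i" by blast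
    qed
  qed
  have edge: "\<phi> ` A \<in> G" if "A \<in> edges (H3 b1 b2 b3)" for A
  proof -
    have "A \<in> H3_edge b1 b2 b3 ` {1, 2, 3}" using that by (simp only: H3_def snd_conv)
    then obtain i where i: "A = H3_edge b1 b2 b3 i" "i \<in> {1, 2, 3}" by (rule imageE)
    show ?thesis using sub[OF i(2)] unfolding i(1) img[OF i(2)] by (rule conjunct1)
  qed
  have "\<phi> ` H3_verts b1 b2 b3 \<subseteq> V"
  proof
    fix x assume "x \<in> \<phi> ` H3_verts b1 b2 b3"
    then obtain v where "v \<in> H3_verts b1 b2 b3" "x = \<phi> v" by blast
    then show "x \<in> V" using mem[of v] by (simp add: R_def)
  qed
  moreover have "verts (H3 b1 b2 b3) = H3_verts b1 b2 b3" by (simp add: H3_def)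
  ultimately show ?thesis
    unfolding contains_copy_def fst_conv snd_conv using inj edge by metis
qed

section \<open>Bounds on the extremal number\<close>

lemma hfree_empty: "edges H \<noteq> {} \<Longrightarrow> hfree H (V, {})"
  by (auto simp: hfree_def contains_copy_def)

lemma edges_H3_nonempty: "edges (H3 b1 b2 b3) \<noteq> {}"
  by (simp add: H3_def)

lemma finite_ex_set:
  assumes "hypergraph F"
  shows "finite {card G | G. G \<subseteq> edges F \<and> hfree H (verts F, G)}"
proof -
  have "finite (edges F)" using assms unfolding hypergraph_def by (meson finite_Pow_iff finite_subset)
  then show ?thesis by simp
qed

lemma ex_num_le_iff:
  assumes "hypergraph F" "edges H \<noteq> {}"
  shows "ex_num F H \<le> T \<longleftrightarrow> (\<forall>G \<subseteq> edges F. hfree H (verts F, G) \<longrightarrow> card G \<le> T)"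
proof -
  have "{card G | G. G \<subseteq> edges F \<and> hfree H (verts F, G)} \<noteq> {}"
    using hfree_empty[OF assms(2)] by blast
  then show ?thesis
    unfolding ex_num_def by (subst Max_le_iff[OF finite_ex_set[OF assms(1)]]) auto
qed

lemma f_min_attained:
  obtains F :: "nat hypergraph" where "hypergraph F" "card (edges F) = m" "ex_num F H = f_min m H"
proof -
  have "{ex_num F H | F :: nat hypergraph. hypergraph F \<and> card (edges F) = m} \<noteq> {}"
    using hypergraph_exists by blast
  from Inf_nat_def1[OF this] show thesis
    using that unfolding f_min_def by auto
qed

text \<open>An upper bound on the minimum may be witnessed by a host over any vertex type, since a finite
  vertex set can be renamed injectively.\<close>

lemma f_min_le:
  fixes V :: "'a set"
  assumes fin: "finite V" and sub: "E \<subseteq> Pow V" and H: "edges H \<noteq> {}"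
    and bound: "\<And>G. G \<subseteq> E \<Longrightarrow> hfree H (V, G) \<Longrightarrow> card G \<le> T"
  shows "f_min (card E) H \<le> T"
proof -
  obtain h :: "'a \<Rightarrow> nat" where h: "inj_on h V"
    using finite_imp_inj_to_nat_seg[OF fin] by blast
  let ?F = "(h ` V, image h ` E)"
  have hg: "hypergraph ?F" using fin sub by (auto simp: hypergraph_def)
  have inj: "inj_on (image h) E" using inj_on_image_Pow[OF h] sub by (rule inj_on_subset)
  have "card G' \<le> T" if G': "G' \<subseteq> image h ` E" and free: "hfree H (h ` V, G')" for G'
  proof -
    obtain G where G: "G \<subseteq> E" "G' = image h ` G" using G' by (meson subset_imageE)
    have "hfree H (V, G)"
      unfolding hfree_def
    proof
      assume "contains_copy (V, G) H"
      then obtain \<phi> where \<phi>: "inj_on \<phi> (verts H)" "\<phi> ` verts H \<subseteq> V" "\<forall>A\<in>edges H. \<phi> ` A \<in> G"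
        by (auto simp: contains_copy_def)
      then have "inj_on (h \<circ> \<phi>) (verts H)" "(h \<circ> \<phi>) ` verts H \<subseteq> h ` V"
        "\<forall>A\<in>edges H. (h \<circ> \<phi>) ` A \<in> G'"
        using h G(2) by (auto simp del: o_apply simp: image_comp[symmetric] intro: comp_inj_on inj_on_subset)
      then show False
        using free unfolding hfree_def contains_copy_def fst_conv snd_conv by blast
    qed
    then have "card G \<le> T" using bound G(1) by blast
    then show ?thesis using G inj by (metis card_image inj_on_subset)
  qed
  then have "ex_num ?F H \<le> T" using ex_num_le_iff[OF hg H] by simp
  moreover have "card (edges ?F) = card E" using inj by (simp add: card_image)
  then have "f_min (card E) H \<le> ex_num ?F H"
    unfolding f_min_def using hg by (intro cInf_lower) (auto simp del: snd_conv fst_conv)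
  ultimately show ?thesis by simp
qed

section \<open>Hypergraphs all of whose free subgraphs are small\<close>

text \<open>Double counting of incidences.\<close>

lemma sum_card_Int:
  assumes "finite A" "finite \<C>"
  shows "(\<Sum>C\<in>\<C>. card (A \<inter> C)) = (\<Sum>w\<in>A. card {C \<in> \<C>. w \<in> C})"
proof -
  have "(\<Sum>C\<in>\<C>. card (A \<inter> C)) = (\<Sum>C\<in>\<C>. \<Sum>w\<in>A. if w \<in> C then 1 else 0)"
    using assms by (simp add: sum.If_cases Int_def)
  also have "\<dots> = (\<Sum>w\<in>A. \<Sum>C\<in>\<C>. if w \<in> C then 1 else 0)" by (rule sum.swap)
  also have "\<dots> = (\<Sum>w\<in>A. card {C \<in> \<C>. w \<in> C})"
    using assms by (simp add: sum.If_cases Int_def)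
  finally show ?thesis .
qed

locale small_free_subgraphs =
  fixes V :: "'a set" and E :: "'a set set" and b1 b2 T :: nat
  assumes finite_V: "finite V" and E_sub: "E \<subseteq> Pow V"
    and b2_pos: "b2 > 0" and T_pos: "T > 0"
    and free_le: "\<And>G. G \<subseteq> E \<Longrightarrow> hfree (H3 b1 b2 1) (V, G) \<Longrightarrow> card G \<le> T"
begin

abbreviation "k \<equiv> b1 + 2 * b2 + 1"
abbreviation "degree v \<equiv> card {C \<in> E. v \<in> C}"

lemma finite_E: "finite E"
  using finite_V E_sub by (meson finite_Pow_iff finite_subset)

lemma finite_edge: "A \<in> E \<Longrightarrow> finite A"
  using finite_V E_sub by (meson PowD finite_subset subsetD)

text \<open>Every edge outside a largest free subfamily completes a copy together with two edges of that
  subfamily, for which there are at most \<open>T\<^sup>2\<close> ordered choices.\<close>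

lemma popular_pair:
  assumes D: "D \<subseteq> E" "card D > T"
  obtains A B where "A \<in> D" "B \<in> D" "card D \<le> T + T\<^sup>2 * card {C \<in> D. H3_triple b1 b2 A B C}"
proof -
  let ?free = "\<lambda>G. G \<subseteq> D \<and> hfree (H3 b1 b2 1) (V, G)"
  have "?free {}" by (simp add: hfree_empty edges_H3_nonempty)
  moreover have bound: "card G \<le> T" if "?free G" for G using free_le that D(1) by blast
  then have "\<forall>G. ?free G \<longrightarrow> card G < Suc T" by (simp add: less_Suc_eq_le)
  ultimately have "\<exists>I. ?free I \<and> (\<forall>G. ?free G \<longrightarrow> card G \<le> card I)"
    by (rule Lattices_Big.ex_has_greatest_nat)
  then obtain I where I: "?free I" and max: "\<And>G. ?free G \<Longrightarrow> card G \<le> card I" by blast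
  have finD: "finite D" using finite_E D(1) by (rule finite_subset[rotated])
  then have finI: "finite I" using I finite_subset by blast
  define N where "N p = {C \<in> D. H3_triple b1 b2 (fst p) (snd p) C}" for p
  have cover: "D - I \<subseteq> (\<Union>p\<in>I \<times> I. N p)"
  proof
    fix C assume C: "C \<in> D - I"
    \<comment> \<open>By maximality, adding \<open>C\<close> creates a copy, and this copy has to use \<open>C\<close>.\<close>
    have "card (insert C I) > card I" using C finI by simp
    then have "\<not> ?free (insert C I)" using max[of "insert C I"] by linarith
    then have "contains_copy (V, insert C I) (H3 b1 b2 1)"
      using C I unfolding hfree_def by blast
    then obtain X Y Z where XYZ: "X \<in> insert C I" "Y \<in> insert C I" "Z \<in> insert C I"
      and t: "H3_triple b1 b2 X Y Z"
      and copy: "contains_copy (V, {X, Y, Z}) (H3 b1 b2 1)"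
      by (rule contains_copy_imp_triple)
    have "\<not> {X, Y, Z} \<subseteq> I" using I contains_copy_mono[OF copy, of I] unfolding hfree_def by blast
    then consider "X = C" | "Y = C" | "Z = C" using XYZ by blast
    then have "\<exists>A\<in>I. \<exists>B\<in>I. H3_triple b1 b2 A B C"
    proof cases
      case 1
      then have "Y \<in> I" "Z \<in> I" using XYZ H3_triple_distinct[OF t b2_pos] by auto
      moreover have "H3_triple b1 b2 Y Z C" using t 1 by (metis H3_triple_commute)
      ultimately show ?thesis by blast
    next
      case 2
      then have "X \<in> I" "Z \<in> I" using XYZ H3_triple_distinct[OF t b2_pos] by auto
      moreover have "H3_triple b1 b2 X Z C" using t 2 by (metis H3_triple_commute)
      ultimately show ?thesis by blast
    next
      case 3
      then have "X \<in> I" "Y \<in> I" using XYZ H3_triple_distinct[OF t b2_pos] by auto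
      then show ?thesis using t 3 by blast
    qed
    then show "C \<in> (\<Union>p\<in>I \<times> I. N p)" using C by (auto simp: N_def)
  qed
  have finN: "finite (N p)" for p using finD by (simp add: N_def)
  have "D \<noteq> I" using D(2) bound[OF I] by auto
  then have "I \<times> I \<noteq> {}" using I cover by auto
  then have "Max ((\<lambda>q. card (N q)) ` (I \<times> I)) \<in> (\<lambda>q. card (N q)) ` (I \<times> I)"
    using finI by (intro Max_in) auto
  then obtain p where p: "p \<in> I \<times> I" and "card (N p) = Max ((\<lambda>q. card (N q)) ` (I \<times> I))"
    by auto
  then have pmax: "card (N q) \<le> card (N p)" if "q \<in> I \<times> I" for q
    using that finI by simp
  have IT: "card I \<le> T" using bound[OF I] .
  have "card (D - I) \<le> card (\<Union>q\<in>I \<times> I. N q)"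
    using cover finI finN by (intro card_mono) auto
  also have "\<dots> \<le> (\<Sum>q\<in>I \<times> I. card (N q))" using finI by (intro card_UN_le) auto
  also have "\<dots> \<le> card (I \<times> I) * card (N p)" using sum_bounded_above[OF pmax] by simp
  also have "\<dots> \<le> T\<^sup>2 * card (N p)"
    using IT by (simp add: card_cartesian_product power2_eq_square mult_le_mono)
  finally have "card (D - I) \<le> T\<^sup>2 * card (N p)" .
  moreover have "card D = card (D - I) + card I"
    using I finI finD by (simp add: card_Diff_subset card_mono)
  ultimately have "card D \<le> T + T\<^sup>2 * card (N p)" using IT by linarith
  moreover have "fst p \<in> D" "snd p \<in> D" using p I by auto
  ultimately show thesis using that unfolding N_def by blast
qed

text \<open>Edges that share two vertices contain no copy, as its three edges have one common vertex only.\<close>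

lemma codegree_le:
  assumes "v \<noteq> w"
  shows "card {C \<in> E. v \<in> C \<and> w \<in> C} \<le> T"
proof (rule free_le)
  show "hfree (H3 b1 b2 1) (V, {C \<in> E. v \<in> C \<and> w \<in> C})"
    unfolding hfree_def
  proof
    assume "contains_copy (V, {C \<in> E. v \<in> C \<and> w \<in> C}) (H3 b1 b2 1)"
    then obtain A B C where vw: "{v, w} \<subseteq> A \<inter> B \<inter> C" and t: "H3_triple b1 b2 A B C"
      by (rule contains_copy_imp_triple) blast
    have one: "card (A \<inter> B \<inter> C) = 1" using t by (simp add: H3_triple_def)
    then have "card {v, w} \<le> 1" using vw by (metis card_mono card.infinite zero_neq_one)
    then show False using assms by simp
  qed
qed auto

lemma T_le_cube: "T \<le> T ^ 3"
  using T_pos by (simp add: self_le_power)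

text \<open>Among the edges through \<open>v\<close>, many meet one edge \<open>A\<close> in exactly \<open>b2\<close> vertices besides \<open>v\<close>;
  the codegree bound limits how often each of the fewer than \<open>k\<close> vertices of \<open>A - {v}\<close> can serve
  for that.\<close>

lemma degree_le: "b2 * degree v \<le> 2 * T ^ 3 * k"
proof (cases "degree v \<le> T")
  case True
  then have "b2 * degree v \<le> k * T ^ 3" using T_le_cube by (intro mult_le_mono) auto
  then show ?thesis by (simp add: algebra_simps)
next
  case False
  define D where "D = {C \<in> E. v \<in> C}"
  have D: "D \<subseteq> E" "T < card D" using False by (auto simp: D_def)
  obtain A B where AB: "A \<in> D" "B \<in> D" and le: "card D \<le> T + T\<^sup>2 * card {C \<in> D. H3_triple b1 b2 A B C}"
    by (rule popular_pair[OF D])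
  define N where "N = {C \<in> D. H3_triple b1 b2 A B C}"
  have finA: "finite A" "v \<in> A" using AB(1) finite_edge by (auto simp: D_def)
  have finN: "finite N" using finite_E by (simp add: N_def D_def)
  have "b2 * card N \<le> k * T"
  proof (cases "N = {}")
    case True
    then show ?thesis by simp
  next
    case False
    then have cA: "card A = k" by (auto simp: N_def H3_triple_def)
    have "card ((A - {v}) \<inter> C) = b2" if "C \<in> N" for C
    proof -
      have "card (A \<inter> C) = b2 + 1" "v \<in> A \<inter> C"
        using that finA by (auto simp: N_def D_def H3_triple_def)
      moreover have "(A - {v}) \<inter> C = A \<inter> C - {v}" by blast
      ultimately show ?thesis by simp
    qed
    then have "b2 * card N = (\<Sum>C\<in>N. card ((A - {v}) \<inter> C))" by simp
    also have "\<dots> = (\<Sum>w\<in>A - {v}. card {C \<in> N. w \<in> C})"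
      using finA finN by (intro sum_card_Int) auto
    also have "\<dots> \<le> (\<Sum>w\<in>A - {v}. T)"
    proof (rule sum_mono)
      fix w assume w: "w \<in> A - {v}"
      have "card {C \<in> N. w \<in> C} \<le> card {C \<in> E. v \<in> C \<and> w \<in> C}"
        using finite_E by (intro card_mono) (auto simp: N_def D_def)
      also have "\<dots> \<le> T" using w by (intro codegree_le) auto
      finally show "card {C \<in> N. w \<in> C} \<le> T" .
    qed
    also have "\<dots> \<le> k * T" using cA finA by simp
    finally show ?thesis .
  qed
  then have "T\<^sup>2 * (b2 * card N) \<le> T\<^sup>2 * (k * T)" by (rule mult_le_mono2)
  moreover have "b2 * card D \<le> b2 * T + T\<^sup>2 * (b2 * card N)"
    using mult_le_mono2[OF le, of b2] by (simp add: N_def algebra_simps)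
  moreover have "b2 * T \<le> k * T ^ 3" using T_le_cube by (intro mult_le_mono) auto
  moreover have "T\<^sup>2 * (k * T) = k * T ^ 3" by algebra
  ultimately have "b2 * card D \<le> k * T ^ 3 + k * T ^ 3" by linarith
  also have "\<dots> = 2 * T ^ 3 * k" by algebra
  finally show ?thesis unfolding D_def .
qed

text \<open>Here a popular pair is used through its intersection: all third edges pass through one of the
  \<open>b2 + 1\<close> vertices of \<open>A \<inter> B\<close>.\<close>

lemma card_E_le_linear: "card E \<le> T + 4 * T ^ 5 * k"
proof (cases "card E \<le> T")
  case False
  then have "T < card E" by simp
  then obtain A B where AB: "A \<in> E" "B \<in> E"
    and le: "card E \<le> T + T\<^sup>2 * card {C \<in> E. H3_triple b1 b2 A B C}"
    by (rule popular_pair[OF subset_refl])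
  define N where "N = {C \<in> E. H3_triple b1 b2 A B C}"
  have finN: "finite N" using finite_E by (simp add: N_def)
  have "card N \<le> 4 * T ^ 3 * k"
  proof (cases "N = {}")
    case False
    then have cAB: "card (A \<inter> B) = b2 + 1" by (auto simp: N_def H3_triple_def)
    have "card N = (\<Sum>C\<in>N. card ((A \<inter> B) \<inter> C))" by (simp add: N_def H3_triple_def)
    also have "\<dots> = (\<Sum>w\<in>A \<inter> B. card {C \<in> N. w \<in> C})"
      using finite_edge[OF AB(1)] finN by (intro sum_card_Int) auto
    also have "\<dots> \<le> (\<Sum>w\<in>A \<inter> B. degree w)"
      using finite_E by (intro sum_mono card_mono) (auto simp: N_def)
    finally have "b2 * card N \<le> (\<Sum>w\<in>A \<inter> B. b2 * degree w)"
      by (simp add: sum_distrib_left[symmetric])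
    also have "\<dots> \<le> (\<Sum>w\<in>A \<inter> B. 2 * T ^ 3 * k)" by (intro sum_mono degree_le)
    also have "\<dots> = (b2 + 1) * (2 * T ^ 3 * k)" using cAB by simp
    also have "\<dots> \<le> (2 * b2) * (2 * T ^ 3 * k)" using b2_pos by (intro mult_le_mono1) simp
    also have "\<dots> = b2 * (4 * T ^ 3 * k)" by simp
    finally show ?thesis using b2_pos by simp
  qed simp
  then have "T\<^sup>2 * card N \<le> T\<^sup>2 * (4 * T ^ 3 * k)" by (rule mult_le_mono2)
  also have "\<dots> = 4 * T ^ 5 * k" by algebra
  finally show ?thesis using le by (simp add: N_def)
qed simp

text \<open>Here only one edge \<open>A\<close> of a popular pair is used: the third edges have \<open>b2 + 1\<close> incidences
  each with the \<open>k\<close> vertices of \<open>A\<close>. Up to constants, this improves on the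
  linear bound when \<open>b2\<^sup>2\<close> exceeds \<open>k\<close>.\<close>

lemma card_E_le_quadratic: "card E * b2\<^sup>2 \<le> T * b2\<^sup>2 + 2 * T ^ 5 * k\<^sup>2"
proof (cases "card E \<le> T")
  case True
  then show ?thesis by (simp add: trans_le_add1)
next
  case False
  then have "T < card E" by simp
  then obtain A B where AB: "A \<in> E" "B \<in> E"
    and le: "card E \<le> T + T\<^sup>2 * card {C \<in> E. H3_triple b1 b2 A B C}"
    by (rule popular_pair[OF subset_refl])
  define N where "N = {C \<in> E. H3_triple b1 b2 A B C}"
  have finN: "finite N" using finite_E by (simp add: N_def)
  have "card N * b2\<^sup>2 \<le> 2 * T ^ 3 * k\<^sup>2"
  proof (cases "N = {}")
    case False
    then have cA: "card A = k" by (auto simp: N_def H3_triple_def)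
    have "b2 * card N \<le> (\<Sum>C\<in>N. card (A \<inter> C))" by (simp add: N_def H3_triple_def)
    also have "\<dots> = (\<Sum>w\<in>A. card {C \<in> N. w \<in> C})"
      using finite_edge[OF AB(1)] finN by (intro sum_card_Int) auto
    also have "\<dots> \<le> (\<Sum>w\<in>A. degree w)"
      using finite_E by (intro sum_mono card_mono) (auto simp: N_def)
    finally have "b2 * (b2 * card N) \<le> (\<Sum>w\<in>A. b2 * degree w)"
      by (simp add: sum_distrib_left[symmetric])
    also have "\<dots> \<le> (\<Sum>w\<in>A. 2 * T ^ 3 * k)" by (intro sum_mono degree_le)
    also have "\<dots> = k * (2 * T ^ 3 * k)" using cA by simp
    also have "\<dots> = 2 * T ^ 3 * k\<^sup>2" by algebra
    also have "b2 * (b2 * card N) = card N * b2\<^sup>2" by algebra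
    finally show ?thesis .
  qed simp
  then have "T\<^sup>2 * (card N * b2\<^sup>2) \<le> T\<^sup>2 * (2 * T ^ 3 * k\<^sup>2)" by (rule mult_le_mono2)
  also have "\<dots> = 2 * T ^ 5 * k\<^sup>2" by algebra
  finally have "T\<^sup>2 * (card N * b2\<^sup>2) \<le> 2 * T ^ 5 * k\<^sup>2" .
  moreover have "card E * b2\<^sup>2 \<le> T * b2\<^sup>2 + T\<^sup>2 * (card N * b2\<^sup>2)"
    using mult_le_mono1[OF le, of "b2\<^sup>2"] by (simp add: N_def algebra_simps)
  ultimately show ?thesis by linarith
qed

end

lemma small_free_subgraphsI:
  assumes "f_min m (H3 b1 b2 1) \<le> T" "b2 > 0" "T > 0"
  obtains E :: "nat set set" and V where "small_free_subgraphs V E b1 b2 T" "card E = m"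
proof -
  obtain F :: "nat hypergraph" where F: "hypergraph F" "card (edges F) = m"
    "ex_num F (H3 b1 b2 1) = f_min m (H3 b1 b2 1)"
    by (rule f_min_attained)
  have "small_free_subgraphs (verts F) (edges F) b1 b2 T"
    using F assms ex_num_le_iff[OF F(1) edges_H3_nonempty, of b1 b2 1 T]
    by unfold_locales (auto simp: hypergraph_def)
  then show thesis using that F(2) by blast
qed

lemma card_le_if_f_min_le:
  assumes "f_min m (H3 b1 b2 1) \<le> T" "b2 > 0" "T > 0"
  shows "m \<le> T + 4 * T ^ 5 * (b1 + 2 * b2 + 1)"
    and "m * b2\<^sup>2 \<le> T * b2\<^sup>2 + 2 * T ^ 5 * (b1 + 2 * b2 + 1)\<^sup>2"
  using small_free_subgraphsI[OF assms]
    small_free_subgraphs.card_E_le_linear small_free_subgraphs.card_E_le_quadratic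
  by (metis, metis)

section \<open>Blocks of edges in which every triple is a copy\<close>

text \<open>Edges are indexed by natural numbers and split into blocks of \<open>g\<close> consecutive indices. A vertex
  is a pair of a set \<open>S\<close> of indices and a counter; it lies in exactly the edges with index in \<open>S\<close>.
  The sets that occur are the singletons, the pairs within a block, and the whole blocks. Blocks are
  complete even if only some of their indices belong to the host hypergraph, so that all edges
  look alike.\<close>

definition block :: "nat \<Rightarrow> nat \<Rightarrow> nat set" where
  "block g i = {l. l div g = i div g}"

text \<open>The number of private vertices is what remains of \<open>b1\<close> once the \<open>g - 3\<close> pairs that leave a
  given triple are accounted for. Singletons and pairs are not confused with blocks because blocks
  have at least three elements wherever this is applied.\<close>

definition block_mult :: "nat \<Rightarrow> nat \<Rightarrow> nat \<Rightarrow> nat set \<Rightarrow> nat" where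
  "block_mult g b1 b2 S =
    (if card S = 1 then b1 - (g - 3) * b2 else if card S = 2 then b2 else 1)"

definition block_edge :: "nat \<Rightarrow> nat \<Rightarrow> nat \<Rightarrow> nat \<Rightarrow> (nat set \<times> nat) set" where
  "block_edge g b1 b2 i =
    {(S, j). i \<in> S \<and> S \<subseteq> block g i \<and> card S \<in> {1, 2, g} \<and> j < block_mult g b1 b2 S}"

lemma block_eq:
  assumes "g > 0"
  shows "block g i = {i div g * g..<i div g * g + g}"
proof (intro equalityI subsetI)
  fix l assume "l \<in> block g i"
  then show "l \<in> {i div g * g..<i div g * g + g}"
    using div_times_less_eq_dividend[of l g] dividend_less_div_times[OF assms, of l]
    by (simp add: block_def add.commute)
next
  fix l assume "l \<in> {i div g * g..<i div g * g + g}"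
  then show "l \<in> block g i"
    by (simp add: block_def div_nat_eqI mult.commute)
qed

lemma finite_block: "g > 0 \<Longrightarrow> finite (block g i)" and card_block: "g > 0 \<Longrightarrow> card (block g i) = g"
  by (simp_all add: block_eq)

lemma finite_block_edge: "g > 0 \<Longrightarrow> finite (block_edge g b1 b2 i)"
proof -
  assume "g > 0"
  moreover have "block_edge g b1 b2 i \<subseteq> Pow (block g i) \<times> {..<b1 + b2 + 1}"
    by (auto simp: block_edge_def block_mult_def split: if_splits)
  ultimately show ?thesis by (metis finite_subset finite_SigmaI finite_Pow_iff finite_block finite_lessThan)
qed

text \<open>If \<open>b2 = 0\<close> there are private vertices to tell two edges apart; otherwise a pair with a third
  index of the block does it.\<close>

lemma inj_block_edge:
  assumes g: "g \<ge> 3" and b: "b1 + b2 > 0"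
  shows "inj (block_edge g b1 b2)"
proof (rule injI)
  fix i j assume eq: "block_edge g b1 b2 i = block_edge g b1 b2 j"
  have B: "finite (block g i)" "card (block g i) = g" using g finite_block card_block by auto
  have i: "i \<in> block g i" by (simp add: block_def)
  have "(block g i, 0) \<in> block_edge g b1 b2 i"
    using g B i by (simp add: block_edge_def block_mult_def)
  then have j: "j \<in> block g i" unfolding eq by (simp add: block_edge_def)
  show "i = j"
  proof (rule ccontr)
    assume ij: "i \<noteq> j"
    show False
    proof (cases "b2 = 0")
      case True
      then have "({i}, 0) \<in> block_edge g b1 b2 i"
        using b i by (simp add: block_edge_def block_mult_def)
      then have "({i}, 0) \<in> block_edge g b1 b2 j" unfolding eq .
      then show False using ij by (simp add: block_edge_def)
    next
      case False
      have "\<not> block g i \<subseteq> {i, j}" using B g card_mono[of "{i, j}" "block g i"] ij by auto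
      then obtain l where l: "l \<in> block g i" "l \<noteq> i" "l \<noteq> j" by blast
      then have "({i, l}, 0) \<in> block_edge g b1 b2 i"
        using False i by (simp add: block_edge_def block_mult_def)
      then have "({i, l}, 0) \<in> block_edge g b1 b2 j" unfolding eq .
      then show False using ij l by (simp add: block_edge_def)
    qed
  qed
qed

text \<open>With \<open>L\<close> a triple of indices in a block \<open>B\<close>, the sum runs over the kinds of vertices lying in
  exactly the edges \<open>K\<close> of that triple, so this computes the regions of the triple. For \<open>K = L\<close>
  only \<open>B\<close> contributes, for a pair only \<open>K\<close> itself, and for \<open>K = {x}\<close> the singleton and the
  \<open>g - 3\<close> pairs of \<open>x\<close> with an index outside \<open>L\<close>.\<close>

lemma sum_block_mult:
  assumes g: "g \<ge> 3" "(g - 3) * b2 \<le> b1"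
    and B: "finite B" "card B = g" and L: "L \<subseteq> B" "card L = 3" and K: "K \<subseteq> L" "K \<noteq> {}"
  shows "(\<Sum>S | S \<subseteq> B \<and> card S \<in> {1, 2, g} \<and> S \<inter> L = K. block_mult g b1 b2 S) =
    H3_mult b1 b2 1 (card K)"
proof -
  let ?S = "{S. S \<subseteq> B \<and> card S \<in> {1, 2, g} \<and> S \<inter> L = K}"
  have fin: "finite S" if "S \<subseteq> B" for S using B that finite_subset by blast
  have full: "S = B" if "S \<subseteq> B" "card S = g" for S using card_subset_eq[OF B(1)] B(2) that by auto
  have finL: "finite L" using L fin by blast
  have finK: "finite K" using finL K finite_subset by blast
  have KB: "K \<subseteq> B" using K L by blast
  have "card K \<noteq> 0" using K finK by simp
  moreover have "card K \<le> 3" using K L finL by (metis card_mono)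
  ultimately consider "card K = 3" | "card K = 2" | "card K = 1" by linarith
  then show ?thesis
  proof cases
    case 1
    then have KL: "K = L" using K L finL by (intro card_subset_eq) auto
    have "?S = {B}"
    proof (intro equalityI subsetI)
      fix S assume S: "S \<in> ?S"
      then have "L \<subseteq> S" using KL by blast
      then have "3 \<le> card S" using L S fin by (metis (no_types, lifting) card_mono mem_Collect_eq)
      then show "S \<in> {B}" using S full by auto
    qed (use B L KL in auto)
    then show ?thesis using g B 1 by (simp add: block_mult_def H3_mult_def)
  next
    case 2
    have "?S = {K}"
    proof (intro equalityI subsetI)
      fix S assume S: "S \<in> ?S"
      have "S \<noteq> B"
      proof
        assume "S = B"
        then have "K = L" using S L(1) by blast
        then show False using L(2) 2 by simp
      qed
      then have "card S \<le> 2" using S full by auto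
      moreover have "K \<subseteq> S" using S by blast
      ultimately have "K = S" using S fin 2 by (intro card_seteq) auto
      then show "S \<in> {K}" by simp
    qed (use K KB 2 in auto)
    then show ?thesis using 2 by (simp add: block_mult_def H3_mult_def)
  next
    case 3
    then obtain x where x: "K = {x}" by (auto simp: card_1_singleton_iff)
    have S_eq: "?S = insert {x} ((\<lambda>l. {x, l}) ` (B - L))"
    proof (intro equalityI subsetI)
      fix S assume S: "S \<in> ?S"
      then have xS: "x \<in> S" using x by blast
      have "S \<noteq> B"
      proof
        assume "S = B"
        then have "K = L" using S L(1) by blast
        then show False using L(2) 3 by simp
      qed
      then consider "card S = 1" | "card S = 2" using S full by auto
      then show "S \<in> insert {x} ((\<lambda>l. {x, l}) ` (B - L))"
      proof cases
        case 1
        then show ?thesis using xS by (auto simp: card_1_singleton_iff)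
      next
        case 2
        then obtain l where l: "S = {x, l}" "l \<noteq> x" using xS by (auto simp: card_2_iff)
        then have "l \<in> B - L" using S x by auto
        then show ?thesis using l by blast
      qed
    next
      fix S assume "S \<in> insert {x} ((\<lambda>l. {x, l}) ` (B - L))"
      then consider "S = {x}" | l where "S = {x, l}" "l \<in> B - L" by blast
      then show "S \<in> ?S"
      proof cases
        case 1
        then show ?thesis using K KB x by auto
      next
        case 2
        then have "x \<noteq> l" using K x by auto
        then show ?thesis using 2 K KB x by auto
      qed
    qed
    have xL: "x \<in> L" using K x by simp
    have "inj_on (\<lambda>l. {x, l}) (B - L)" by (auto simp: inj_on_def doubleton_eq_iff)
    then have "(\<Sum>S\<in>(\<lambda>l. {x, l}) ` (B - L). block_mult g b1 b2 S) =
        (\<Sum>l\<in>B - L. block_mult g b1 b2 {x, l})"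
      by (simp add: sum.reindex)
    also have "\<dots> = (\<Sum>l\<in>B - L. b2)"
    proof (rule sum.cong)
      fix l assume "l \<in> B - L"
      then have "x \<noteq> l" using xL by blast
      then show "block_mult g b1 b2 {x, l} = b2" by (simp add: block_mult_def)
    qed simp
    also have "\<dots> = (g - 3) * b2" using B L finL by (simp add: card_Diff_subset)
    finally have pairs: "(\<Sum>S\<in>(\<lambda>l. {x, l}) ` (B - L). block_mult g b1 b2 S) = (g - 3) * b2" .
    have "{x} \<notin> (\<lambda>l. {x, l}) ` (B - L)" using xL by auto
    then have "(\<Sum>S\<in>?S. block_mult g b1 b2 S) = block_mult g b1 b2 {x} + (g - 3) * b2"
      unfolding S_eq using B pairs by (subst sum.insert) auto
    then show ?thesis using g(2) by (simp add: block_mult_def H3_mult_def x)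
  qed
qed

lemma contains_copy_block:
  fixes a :: "nat \<Rightarrow> nat"
  assumes g: "g \<ge> 3" "(g - 3) * b2 \<le> b1"
    and V: "finite V" "\<And>i. i \<in> {1, 2, 3} \<Longrightarrow> block_edge g b1 b2 (a i) \<subseteq> V"
    and G: "\<And>i. i \<in> {1, 2, 3} \<Longrightarrow> block_edge g b1 b2 (a i) \<in> G"
    and inj: "inj_on a {1, 2, 3}" and B: "\<And>i. i \<in> {1, 2, 3} \<Longrightarrow> block g (a i) = B"
  shows "contains_copy (V, G) (H3 b1 b2 1)"
proof (rule contains_copyI[where X = "\<lambda>i. block_edge g b1 b2 (a i)", OF V(1)])
  fix I :: "nat set" assume I: "I \<subseteq> {1, 2, 3}" "I \<noteq> {}"
  let ?L = "a ` {1, 2, 3}" and ?K = "a ` I"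
  let ?S = "{S. S \<subseteq> B \<and> card S \<in> {1, 2, g} \<and> S \<inter> ?L = ?K}"
  have finB: "finite B" "card B = g"
    using B[of 1] g finite_block[of g "a 1"] card_block[of g "a 1"] by auto
  have aB: "a i \<in> B" if "i \<in> {1, 2, 3}" for i
    using B[OF that] by (auto simp: block_def)
  have mem: "(S, j) \<in> block_edge g b1 b2 (a i) \<longleftrightarrow>
      a i \<in> S \<and> S \<subseteq> B \<and> card S \<in> {1, 2, g} \<and> j < block_mult g b1 b2 S"
    if "i \<in> {1, 2, 3}" for i S j
    using B[OF that] by (simp add: block_edge_def)
  have "{v \<in> V. \<forall>i\<in>{1, 2, 3}. v \<in> block_edge g b1 b2 (a i) \<longleftrightarrow> i \<in> I} =
      (SIGMA S:?S. {..<block_mult g b1 b2 S})" (is "?l = ?r")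
  proof (intro equalityI subsetI)
    fix v assume v: "v \<in> ?l"
    obtain S j where Sj: "v = (S, j)" by (cases v)
    obtain i where i: "i \<in> I" "i \<in> {1, 2, 3}" using I by blast
    then have "v \<in> block_edge g b1 b2 (a i)" using v by blast
    then have S: "S \<subseteq> B" "card S \<in> {1, 2, g}" "j < block_mult g b1 b2 S"
      unfolding Sj mem[OF i(2)] by simp_all
    have "\<forall>i\<in>{1, 2, 3}. v \<in> block_edge g b1 b2 (a i) \<longleftrightarrow> i \<in> I"
      using CollectD[OF v] by (rule conjunct2)
    then have aS: "a l \<in> S \<longleftrightarrow> l \<in> I" if "l \<in> {1, 2, 3}" for l
      using that S unfolding Sj by (metis mem[OF that])
    have "S \<inter> a ` U = a ` I" if "I \<subseteq> U" "\<And>l. l \<in> U \<Longrightarrow> a l \<in> S \<longleftrightarrow> l \<in> I" for U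
      using that by (auto simp: subset_iff)
    from this[OF I(1) aS] have "S \<inter> ?L = ?K" .
    then show "v \<in> ?r" using S Sj by simp
  next
    fix v assume v: "v \<in> ?r"
    then obtain S j where Sj: "v = (S, j)" and S: "S \<subseteq> B" "card S \<in> {1, 2, g}" "S \<inter> ?L = ?K"
      "j < block_mult g b1 b2 S"
      by blast
    have aS: "a l \<in> S \<longleftrightarrow> l \<in> I" if "l \<in> {1, 2, 3}" for l
    proof -
      have "a l \<in> S \<longleftrightarrow> a l \<in> ?K" using S(3) that by blast
      then show ?thesis using inj_on_image_mem_iff[OF inj that I(1)] by blast
    qed
    then have iff: "v \<in> block_edge g b1 b2 (a l) \<longleftrightarrow> l \<in> I" if "l \<in> {1, 2, 3}" for l
      unfolding Sj mem[OF that] using S(1,2,4) aS[OF that] by (simp only: simp_thms)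
    obtain i where "i \<in> I" "i \<in> {1, 2, 3}" using I by blast
    then have "v \<in> V" using iff V(2) by blast
    moreover have "\<forall>l\<in>{1, 2, 3}. v \<in> block_edge g b1 b2 (a l) \<longleftrightarrow> l \<in> I"
      using iff by (rule ballI)
    ultimately show "v \<in> ?l" by (intro CollectI conjI)
  qed
  moreover have "finite ?S" using finB by (auto intro: finite_subset[of _ "Pow B"])
  ultimately have "card ?l = (\<Sum>S\<in>?S. block_mult g b1 b2 S)" by simp
  also have "\<dots> = H3_mult b1 b2 1 (card ?K)"
  proof (rule sum_block_mult[OF g finB])
    show "?L \<subseteq> B" using aB by blast
    show "card ?L = 3" using card_image[OF inj] by simp
    show "?K \<subseteq> ?L" "?K \<noteq> {}" using I by blast+
  qed
  also have "card ?K = card I" using card_image[OF inj_on_subset[OF inj I(1)]] .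
  finally show "card ?l = H3_mult b1 b2 1 (card I)" .
qed (use V G in blast)

text \<open>Three edges of one block always form a copy, so a free family has at most two edges in each of
  the \<open>N\<close> blocks.\<close>

lemma f_min_le_blocks:
  assumes g: "g \<ge> 3" "(g - 3) * b2 \<le> b1" and b: "b1 + b2 > 0" and m: "m \<le> N * g"
  shows "f_min m (H3 b1 b2 1) \<le> 2 * N"
proof -
  let ?e = "block_edge g b1 b2"
  define V where "V = (\<Union>i<m. ?e i)"
  have finV: "finite V" using g finite_block_edge by (simp add: V_def)
  have inj: "inj ?e" using inj_block_edge[OF g(1) b] .
  have "f_min (card (?e ` {..<m})) (H3 b1 b2 1) \<le> 2 * N"
  proof (rule f_min_le[OF finV _ edges_H3_nonempty])
    show "?e ` {..<m} \<subseteq> Pow V" by (auto simp: V_def)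
    fix G assume G: "G \<subseteq> ?e ` {..<m}" "hfree (H3 b1 b2 1) (V, G)"
    then obtain I where I: "I \<subseteq> {..<m}" "G = ?e ` I" by (meson subset_imageE)
    have finI: "finite I" using I finite_subset by blast
    have le2: "card {i \<in> I. i div g = c} \<le> 2" for c
    proof (rule ccontr)
      assume "\<not> card {i \<in> I. i div g = c} \<le> 2"
      then have "3 \<le> card {i \<in> I. i div g = c}" by simp
      then obtain J where J: "J \<subseteq> {i \<in> I. i div g = c}" "card J = 3" "finite J"
        by (rule obtain_subset_with_card_n)
      then obtain a where a: "bij_betw a {1, 2, 3::nat} J"
        using finite_same_card_bij[of "{1, 2, 3::nat}" J] by auto
      then have aJ: "a i \<in> I" "a i div g = c" "a i < m" if "i \<in> {1, 2, 3}" for i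
        using bij_betwE[OF a] that J I(1) by blast+
      have "contains_copy (V, G) (H3 b1 b2 1)"
      proof (rule contains_copy_block[OF g finV, where B = "{l. l div g = c}"])
        show "inj_on a {1, 2, 3}" using a by (rule bij_betw_imp_inj_on)
      next
        fix i :: nat assume i: "i \<in> {1, 2, 3}"
        show "?e (a i) \<subseteq> V" using aJ(3)[OF i] unfolding V_def by blast
        show "?e (a i) \<in> G" using aJ(1)[OF i] I(2) by blast
        show "block g (a i) = {l. l div g = c}" using aJ(2)[OF i] by (simp add: block_def)
      qed
      then show False using G(2) by (simp add: hfree_def)
    qed
    have "I \<subseteq> (\<Union>c<N. {i \<in> I. i div g = c})"
    proof
      fix i assume i: "i \<in> I"
      then have "i < N * g" using I(1) m by auto
      then have "i div g < N" by (simp add: less_mult_imp_div_less)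
      then show "i \<in> (\<Union>c<N. {i \<in> I. i div g = c})" using i by blast
    qed
    then have "card I \<le> card (\<Union>c<N. {i \<in> I. i div g = c})" using finI by (intro card_mono) auto
    also have "\<dots> \<le> (\<Sum>c<N. card {i \<in> I. i div g = c})" by (intro card_UN_le) simp
    also have "\<dots> \<le> 2 * N" using sum_bounded_above[of "{..<N}" "\<lambda>c. card {i \<in> I. i div g = c}" 2] le2 by simp
    finally show "card G \<le> 2 * N" using I(2) card_image_le[OF finI, of ?e] by simp
  qed
  moreover have "card (?e ` {..<m}) = m" using inj by (simp add: card_image inj_on_subset)
  ultimately show ?thesis by simp
qed

section \<open>Asymptotics\<close>

lemma bdd_above_f_min:
  assumes three: "\<forall>\<^sub>F m in sequentially. b1 m + b2 m > 0"
    and \<Omega>: "(\<lambda>m. real (b1 m)) \<in> \<Omega>(\<lambda>m. real m * real (b2 m))"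
  shows "bdd_above (range (\<lambda>m. f_min m (H3 (b1 m) (b2 m) 1)))"
proof -
  obtain c where c: "c > 0"
    and ev: "\<forall>\<^sub>F m in sequentially. norm (real (b1 m)) \<ge> c * norm (real m * real (b2 m))"
    using \<Omega> by (rule landau_omega.bigE)
  define N where "N = nat \<lceil>1 / c\<rceil>"
  have N: "1 / c \<le> real N" unfolding N_def by (rule real_nat_ceiling_ge)
  have "\<forall>\<^sub>F m in sequentially. f_min m (H3 (b1 m) (b2 m) 1) \<le> 2 * N"
    using ev three
  proof eventually_elim
    case (elim m)
    note le = elim(1) and pos = elim(2)
    \<comment> \<open>The largest block size that the condition \<open>(g - 3) * b2 \<le> b1\<close> is sure to allow.\<close>
    define g where "g = nat \<lfloor>c * real m\<rfloor> + 3"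
    have "real (nat \<lfloor>c * real m\<rfloor>) \<le> c * real m" using c by simp
    then have "real ((g - 3) * b2 m) \<le> c * real m * real (b2 m)"
      by (simp add: g_def mult_right_mono)
    also have "\<dots> \<le> real (b1 m)" using le by (simp add: abs_mult mult.assoc)
    finally have g: "(g - 3) * b2 m \<le> b1 m" by linarith
    have "c * real m \<le> real g" unfolding g_def using c by linarith
    with N have "(1 / c) * (c * real m) \<le> real N * real g"
      using c by (intro mult_mono) simp_all
    then have "real m \<le> real (N * g)" using c by simp
    then have "m \<le> N * g" by (simp only: of_nat_le_iff)
    then show "f_min m (H3 (b1 m) (b2 m) 1) \<le> 2 * N"
      using g pos by (intro f_min_le_blocks[of g]) (auto simp: g_def)
  qed
  then obtain M where M: "\<And>m. m \<ge> M \<Longrightarrow> f_min m (H3 (b1 m) (b2 m) 1) \<le> 2 * N"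
    by (auto simp: eventually_sequentially)
  have "range (\<lambda>m. f_min m (H3 (b1 m) (b2 m) 1)) \<subseteq>
      (\<lambda>m. f_min m (H3 (b1 m) (b2 m) 1)) ` {..<M} \<union> {..2 * N}"
  proof (rule image_subsetI)
    fix m
    show "f_min m (H3 (b1 m) (b2 m) 1) \<in>
        (\<lambda>m. f_min m (H3 (b1 m) (b2 m) 1)) ` {..<M} \<union> {..2 * N}"
      using M[of m] by (cases "m < M") auto
  qed
  then show ?thesis by (rule bdd_above_mono[rotated]) simp
qed

lemma not_bdd_above_linear:
  assumes b2: "\<forall>\<^sub>F m in sequentially. b2 m > 0"
    and o: "(\<lambda>m. real (b1 m) + real (b2 m)) \<in> o(\<lambda>m. real m)"
  shows "\<not> bdd_above (range (\<lambda>m. f_min m (H3 (b1 m) (b2 m) 1)))"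
proof
  assume "bdd_above (range (\<lambda>m. f_min m (H3 (b1 m) (b2 m) 1)))"
  then obtain T0 where T0: "\<And>m. f_min m (H3 (b1 m) (b2 m) 1) \<le> T0"
    unfolding bdd_above_def by auto
  define T where "T = T0 + 1"
  have T: "f_min m (H3 (b1 m) (b2 m) 1) \<le> T" "T > 0" for m
    using T0[of m] by (auto simp: T_def)
  \<comment> \<open>This makes the term with \<open>b1 + b2\<close> in the linear bound at most \<open>m / 2\<close>.\<close>
  define c where "c = 1 / (24 * real T ^ 5)"
  have c: "c > 0" using T by (simp add: c_def)
  have "\<forall>\<^sub>F m in sequentially. real (b1 m) + real (b2 m) \<le> c * real m"
    using landau_o.smallD[OF o c] by simp
  then have "\<forall>\<^sub>F m in sequentially. m \<le> 2 * T"
    using b2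
  proof eventually_elim
    case (elim m)
    have "m \<le> T + 4 * T ^ 5 * (b1 m + 2 * b2 m + 1)"
      using card_le_if_f_min_le(1)[OF T(1) elim(2) T(2)] .
    also have "\<dots> \<le> T + 4 * T ^ 5 * (3 * (b1 m + b2 m))"
      using elim(2) by (intro add_left_mono mult_le_mono2) simp
    also have "\<dots> = T + 12 * T ^ 5 * (b1 m + b2 m)" by simp
    finally have "real m \<le> real (T + 12 * T ^ 5 * (b1 m + b2 m))" by (rule of_nat_mono)
    also have "\<dots> = real T + 12 * real T ^ 5 * (real (b1 m) + real (b2 m))" by simp
    also have "\<dots> \<le> real T + 12 * real T ^ 5 * (c * real m)"
      using elim(1) by (intro add_left_mono mult_left_mono) auto
    also have "\<dots> = real T + real m / 2" using T(2) by (simp add: c_def)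
    finally show ?case by linarith
  qed
  then obtain M where "\<And>m. m \<ge> M \<Longrightarrow> m \<le> 2 * T" by (auto simp: eventually_sequentially)
  from this[of "max M (2 * T + 1)"] show False by simp
qed

lemma not_bdd_above_sqrt:
  assumes three: "\<forall>\<^sub>F m in sequentially. b1 m + b2 m > 0"
    and o: "(\<lambda>m. real (b1 m)) \<in> o(\<lambda>m. sqrt (real m) * real (b2 m))"
  shows "\<not> bdd_above (range (\<lambda>m. f_min m (H3 (b1 m) (b2 m) 1)))"
proof
  assume "bdd_above (range (\<lambda>m. f_min m (H3 (b1 m) (b2 m) 1)))"
  then obtain T0 where T0: "\<And>m. f_min m (H3 (b1 m) (b2 m) 1) \<le> T0"
    unfolding bdd_above_def by auto
  define T where "T = T0 + 1"
  have T: "f_min m (H3 (b1 m) (b2 m) 1) \<le> T" "T > 0" for m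
    using T0[of m] by (auto simp: T_def)
  \<comment> \<open>This makes the part of the quadratic bound that grows with \<open>m\<close> equal to \<open>m / 2\<close>.\<close>
  define c where "c = 1 / sqrt (8 * real T ^ 5)"
  have c: "c > 0" using T by (simp add: c_def)
  have c2: "c\<^sup>2 = 1 / (8 * real T ^ 5)" by (simp add: c_def power_divide)
  have "\<forall>\<^sub>F m in sequentially. real (b1 m) \<le> c * (sqrt (real m) * real (b2 m))"
    using landau_o.smallD[OF o c] by (simp add: abs_mult)
  then have "\<forall>\<^sub>F m in sequentially. m \<le> 2 * T + 72 * T ^ 5"
    using three
  proof eventually_elim
    case (elim m)
    \<comment> \<open>Otherwise \<open>b1\<close> would vanish as well, and the three edges would coincide.\<close>
    have b2: "b2 m > 0" using elim by (cases "b2 m = 0") auto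
    have "real (b1 m + 2 * b2 m + 1) \<le> real (b1 m) + 3 * real (b2 m)" using b2 by simp
    also have "\<dots> \<le> (c * sqrt (real m) + 3) * real (b2 m)" using elim(1) by (simp add: algebra_simps)
    finally have "real (b1 m + 2 * b2 m + 1) ^ 2 \<le> ((c * sqrt (real m) + 3) * real (b2 m))\<^sup>2"
      by (intro power_mono) auto
    also have "\<dots> = (c * sqrt (real m) + 3)\<^sup>2 * (real (b2 m))\<^sup>2" by (rule power_mult_distrib)
    \<comment> \<open>The inequality \<open>(x + y)\<^sup>2 \<le> 2 * x\<^sup>2 + 2 * y\<^sup>2\<close> for \<open>y = 3\<close>.\<close>
    also have "\<dots> \<le> (2 * (c * sqrt (real m))\<^sup>2 + 18) * (real (b2 m))\<^sup>2"
    proof (rule mult_right_mono)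
      show "(c * sqrt (real m) + 3)\<^sup>2 \<le> 2 * (c * sqrt (real m))\<^sup>2 + 18"
        using zero_le_power2[of "c * sqrt (real m) - 3"] by (simp add: power2_eq_square algebra_simps)
    qed simp
    also have "(c * sqrt (real m))\<^sup>2 = c\<^sup>2 * real m" by (simp add: power_mult_distrib)
    finally have k: "real (b1 m + 2 * b2 m + 1) ^ 2 \<le> (2 * (c\<^sup>2 * real m) + 18) * (real (b2 m))\<^sup>2" .
    have "real (m * (b2 m)\<^sup>2) \<le> real (T * (b2 m)\<^sup>2 + 2 * T ^ 5 * (b1 m + 2 * b2 m + 1)\<^sup>2)"
      using card_le_if_f_min_le(2)[OF T(1) b2 T(2)] by (rule of_nat_mono)
    then have "real m * (real (b2 m))\<^sup>2 \<le>
        real T * (real (b2 m))\<^sup>2 + 2 * real T ^ 5 * real (b1 m + 2 * b2 m + 1) ^ 2"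
      by (simp only: of_nat_mult of_nat_add of_nat_power of_nat_numeral)
    also have "\<dots> \<le> real T * (real (b2 m))\<^sup>2 +
        2 * real T ^ 5 * ((2 * (c\<^sup>2 * real m) + 18) * (real (b2 m))\<^sup>2)"
      using k by (intro add_left_mono mult_left_mono) auto
    also have "\<dots> = (real T + real m / 2 + 36 * real T ^ 5) * (real (b2 m))\<^sup>2"
      using T(2) by (simp add: c2 field_simps)
    finally have "real m \<le> real T + real m / 2 + 36 * real T ^ 5" using b2 by simp
    then have "real m \<le> real (2 * T + 72 * T ^ 5)" by simp
    then show ?case by (simp only: of_nat_le_iff)
  qed
  then obtain M where "\<And>m. m \<ge> M \<Longrightarrow> m \<le> 2 * T + 72 * T ^ 5" by (auto simp: eventually_sequentially)
  from this[of "max M (2 * T + 72 * T ^ 5 + 1)"] show False by simp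
qed

theorem corollary2p9:
  fixes b1 b2 :: "nat \<Rightarrow> nat"
  assumes three_edges: "\<forall>\<^sub>F m in sequentially. card (edges (H3 (b1 m) (b2 m) 1)) = 3"
  shows "((\<lambda>m. real (b1 m)) \<in> \<Omega>(\<lambda>m. real m * real (b2 m)) \<longrightarrow>
           bdd_above (range (\<lambda>m. f_min m (H3 (b1 m) (b2 m) 1)))) \<and>
         ((\<forall>\<^sub>F m in sequentially. b2 m > 0) \<and>
           (\<lambda>m. real (b1 m) + real (b2 m)) \<in> o(\<lambda>m. real m) \<longrightarrow>
           \<not> bdd_above (range (\<lambda>m. f_min m (H3 (b1 m) (b2 m) 1)))) \<and>
         ((\<lambda>m. real (b1 m)) \<in> o(\<lambda>m. sqrt (real m) * real (b2 m)) \<longrightarrow>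
           \<not> bdd_above (range (\<lambda>m. f_min m (H3 (b1 m) (b2 m) 1))))"
proof -
  have pos: "\<forall>\<^sub>F m in sequentially. b1 m + b2 m > 0"
    using three_edges unfolding card_edges_H3 .
  show ?thesis
    using bdd_above_f_min[OF pos] not_bdd_above_linear not_bdd_above_sqrt[OF pos] by blast
qed

end
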